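(* Let $\mathcal{I}=(N,M,\mathcal{V})$ be a fair division instance with additive valuations, let $\epsilon\ge 0$, and let $\mathcal{I}'=(N',M',\mathcal{V}')=\mathtt{reduce}(\mathcal{I},\epsilon)$. Then for every agent $i\in N'$, $\mathrm{MMS}_i(\mathcal{I}')=\mathrm{MMS}^{|N'|}_{v'_i}(M')\ge 1-4\epsilon$.
   Context: An instance $(N,M,\mathcal{V})$ has agents $N=[n]$, a finite set $M$ of $m$ indivisible goods, and additive valuations $v_i:2^M\to\mathbb{R}_{\ge0}$. For a valuation $v$, a set $S$ and integer $d\ge1$, $\mathrm{MMS}^d_v(S)$ is the maximum over all partitions $(P_1,\dots,P_d)$ of $S$ into $d$ bundles of $\min_j v(P_j)$; $\mathrm{MMS}_i=\mathrm{MMS}^{n}_{v_i}(M)$. An instance is ordered if $M=[m]$ and $v_i(1)\ge v_i(2)\ge\dots\ge v_i(m)$ for every agent $i$. For $\mathcal{I}=([n],[m],\mathcal{V})$, $\mathtt{order}(\mathcal{I})=([n],[m],\mathcal{V}')$ where $v'_i(j)$ is the $j$-th largest number in the multiset $\{v_i(g):g\in[m]\}$. Reduction rules for an ordered instance with $n$ agents and threshold $\alpha$: $R^\alpha_1$ is applicable if some agent $i$ has $v_i(\{1\})\ge\alpha$; $R^\alpha_2$ if some $i$ has $v_i(\{2n-1,2n,2n+1\})\ge\alpha$; $R^\alpha_3$ if some $i$ has $v_i(\{3n-2,3n-1,3n,3n+1\})\ge\alpha$; $R^\alpha_4$ if some $i$ has $v_i(\{1,2n+1\})\ge\alpha$.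 Applying the rule gives the corresponding set to such an agent $i$ and removes $i$ and these goods; the remaining goods are re-indexed $1,2,\dots$ preserving their order (so the instance remains ordered). $\mathtt{reduce}(\mathcal{I},\epsilon)$: (1) replace $\mathcal{I}$ by $\mathtt{order}(\mathcal{I})$; (2) for every agent $i$ and good $g$ set $v_i(g)\leftarrow v_i(g)/\mathrm{MMS}_i$ (so every agent's MMS value becomes $1$); (3) while one of $R^{3/4+\epsilon}_1,R^{3/4+\epsilon}_2,R^{3/4+\epsilon}_3,R^{3/4+\epsilon}_4$ is applicable, apply $R^{3/4+\epsilon}_k$ for the smallest applicable $k$. The output is the instance formed by the remaining agents, remaining goods and the valuations from step (2). *)

theory Defs
  imports Complex_Main "HOL-Library.FuncSet" "HOL-Library.Multiset"
begin

text \<open>Additive valuations: a valuation is given by its values on single goods,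
 v(S) = sum v S. Partitions of S into d (possibly empty) bundles are encoded as
 assignments f : S -> {0..<d}; bundle j is {g in S. f g = j}.\<close>

definition mms :: "nat \<Rightarrow> ('a \<Rightarrow> real) \<Rightarrow> 'a set \<Rightarrow> real" where
  "mms d v S = Max {Min ((\<lambda>j. sum v {g \<in> S. f g = j}) ` {..<d}) | f. f \<in> S \<rightarrow>\<^sub>E {..<d}}"

definition ordv :: "'g set \<Rightarrow> (nat \<Rightarrow> 'g \<Rightarrow> real) \<Rightarrow> nat \<Rightarrow> nat \<Rightarrow> real" where
  "ordv M v i j = (if 1 \<le> j \<and> j \<le> card M
     then rev (sorted_list_of_multiset (image_mset (v i) (mset_set M))) ! (j - 1) else 0)"

definition normv :: "nat set \<Rightarrow> 'g set \<Rightarrow> (nat \<Rightarrow> 'g \<Rightarrow> real) \<Rightarrow> nat \<Rightarrow> nat \<Rightarrow> real" where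
  "normv N M v i j = ordv M v i j / mms (card N) (ordv M v i) {1..card M}"

text \<open>Positions (1-based, in the current re-indexed ordered instance with n agents)
 of the goods handed out by rule R_k.\<close>
definition rule_pos :: "nat \<Rightarrow> nat \<Rightarrow> nat set" where
  "rule_pos k n = (if k = 1 then {1}
     else if k = 2 then {2*n-1, 2*n, 2*n+1}
     else if k = 3 then {3*n-2, 3*n-1, 3*n, 3*n+1}
     else {1, 2*n+1})"

text \<open>A state is (remaining agents, remaining goods as a list of original ordered indices in
 increasing order); position p refers to G ! (p-1). Positions beyond the number of remaining
 goods refer to no good.\<close>
definition rule_goods :: "nat \<Rightarrow> nat set \<Rightarrow> nat list \<Rightarrow> nat set" where
  "rule_goods k A G = (\<lambda>p. G ! (p - 1)) ` (rule_pos k (card A) \<inter> {1..length G})"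

definition remove_pos :: "nat \<Rightarrow> nat set \<Rightarrow> nat list \<Rightarrow> nat list" where
  "remove_pos k A G = map (\<lambda>p. G ! (p - 1))
      (filter (\<lambda>p. p \<notin> rule_pos k (card A)) [1..<Suc (length G)])"

definition applicable :: "(nat \<Rightarrow> nat \<Rightarrow> real) \<Rightarrow> real \<Rightarrow> nat \<Rightarrow> nat set \<Rightarrow> nat list \<Rightarrow> bool" where
  "applicable w \<alpha> k A G = (\<exists>i\<in>A. sum (w i) (rule_goods k A G) \<ge> \<alpha>)"

inductive reduce_loop :: "(nat \<Rightarrow> nat \<Rightarrow> real) \<Rightarrow> real \<Rightarrow> nat set \<Rightarrow> nat list \<Rightarrow> nat set \<Rightarrow> nat list \<Rightarrow> bool"
  for w \<alpha> where
  stop: "\<not> (\<exists>k\<in>{1..4}. applicable w \<alpha> k A G) \<Longrightarrow> reduce_loop w \<alpha> A G A G"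
| step: "k \<in> {1..4} \<Longrightarrow> applicable w \<alpha> k A G \<Longrightarrow> (\<forall>k'\<in>{1..<k}. \<not> applicable w \<alpha> k' A G) \<Longrightarrow>
         i \<in> A \<Longrightarrow> sum (w i) (rule_goods k A G) \<ge> \<alpha> \<Longrightarrow>
         reduce_loop w \<alpha> (A - {i}) (remove_pos k A G) A' G' \<Longrightarrow> reduce_loop w \<alpha> A G A' G'"

text \<open>reduce(I, eps) outputs remaining agents N', remaining goods M' (original ordered indices)
 with valuations normv N M v.\<close>
definition reduce :: "nat set \<Rightarrow> 'g set \<Rightarrow> (nat \<Rightarrow> 'g \<Rightarrow> real) \<Rightarrow> real \<Rightarrow> nat set \<Rightarrow> nat set \<Rightarrow> bool" where
  "reduce N M v \<epsilon> N' M' = (\<exists>G'. reduce_loop (normv N M v) (3/4 + \<epsilon>) N [1..<Suc (card M)] N' G'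
      \<and> M' = set G')"

end

theory Submission
  imports Defs
begin

text \<open>
  Put \<open>T = 1 - 4\<epsilon>\<close>, assumed positive. Rules 1 to 3 never decrease the maximin share of a remaining
  agent; rule 4 may, if the agent values the removed pair at more than the share, and such losses
  could accumulate. The remedy is to lower the agent's values once, at the beginning: values of at
  most \<open>1/4 + \<epsilon>/3\<close> are capped at \<open>T/4\<close>, and larger values below \<open>3/4 + \<epsilon>\<close> are capped at \<open>3T/4\<close>.
  The caps preserve the order of the goods, and every bundle of value at least 1 keeps value at
  least \<open>T\<close>: either its capped goods alone are worth \<open>T\<close>, or they are at most one large good or at
  most three small ones, which lose at most \<open>4\<epsilon>\<close> together. When rule 4 applies, rules 1 and 2 do not,
  so the removed pair has capped value at most \<open>3T/4 + T/4 = T\<close>. Hence no rule lowers the capped share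
  below \<open>T\<close>.
\<close>

section \<open>Splittings into bundles worth at least \<open>t\<close>, and maximin shares\<close>

text \<open>Goods with \<^term>\<open>h g \<notin> J\<close> are left unassigned, and the labels in \<^term>\<open>J\<close> are arbitrary, so that
  bundles can be dropped without renumbering.\<close>
definition can_split :: "('a \<Rightarrow> real) \<Rightarrow> real \<Rightarrow> nat \<Rightarrow> 'a set \<Rightarrow> bool" where
  "can_split v t d S \<longleftrightarrow>
     (\<exists>(h :: 'a \<Rightarrow> nat) J. finite J \<and> card J = d \<and> (\<forall>j\<in>J. t \<le> sum v {g \<in> S. h g = j}))"

text \<open>Throwing the unassigned goods into one bundle \<open>j0\<close> lowers no bundle value,
  as the goods are worth at least 0; \<open>0 < d\<close> provides \<open>j0\<close>.\<close>

lemma can_split_surj: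
  assumes "can_split v t d S" "finite S" "\<forall>g\<in>S. 0 \<le> v g" "0 < d"
  obtains h :: "'a \<Rightarrow> nat" and J where "finite J" "card J = d" "\<forall>j\<in>J. t \<le> sum v {g \<in> S. h g = j}"
    "\<forall>g. h g \<in> J"
proof -
  obtain h :: "'a \<Rightarrow> nat" and J where h: "finite J" "card J = d" "\<forall>j\<in>J. t \<le> sum v {g \<in> S. h g = j}"
    using assms(1) by (auto simp: can_split_def)
  obtain j0 where j0: "j0 \<in> J" using h(2) \<open>0 < d\<close> by fastforce
  let ?h = "\<lambda>g. if h g \<in> J then h g else j0"
  have "t \<le> sum v {g \<in> S. ?h g = j}" if "j \<in> J" for j
  proof -
    have "sum v {g \<in> S. h g = j} \<le> sum v {g \<in> S. ?h g = j}"
      using assms that by (intro sum_mono2) auto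
    then show ?thesis using h(3) that by fastforce
  qed
  then show thesis using that[of J ?h] h j0 by auto
qed

lemma can_split_cong:
  assumes "can_split v t d S" "\<And>g. g \<in> S \<Longrightarrow> v g = u g"
  shows "can_split u t d S"
proof -
  have "sum v {g \<in> S. h g = j} = sum u {g \<in> S. h g = j}" for h :: "'a \<Rightarrow> nat" and j
    using assms(2) by (intro sum.cong) auto
  then show ?thesis using assms(1) by (simp add: can_split_def)
qed

lemma can_split_mono:
  assumes "can_split v t d S" "\<And>g. g \<in> S \<Longrightarrow> v g \<le> u g"
  shows "can_split u t d S"
proof -
  have "sum v {g \<in> S. h g = j} \<le> sum u {g \<in> S. h g = j}" for h :: "'a \<Rightarrow> nat" and j
    using assms(2) by (intro sum_mono) auto
  then have "t \<le> sum u {g \<in> S. h g = j}" if "t \<le> sum v {g \<in> S. h g = j}"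
    for h :: "'a \<Rightarrow> nat" and j using that order_trans by blast
  then show ?thesis using assms(1) unfolding can_split_def by metis
qed

lemma can_split_bij:
  assumes "can_split v t d (\<sigma> ` S)" "inj_on \<sigma> S"
  shows "can_split (v \<circ> \<sigma>) t d S"
proof -
  have "sum v {g \<in> \<sigma> ` S. h g = j} = sum (v \<circ> \<sigma>) {g \<in> S. (h \<circ> \<sigma>) g = j}" for h :: "_ \<Rightarrow> nat" and j
  proof -
    have "{g \<in> \<sigma> ` S. h g = j} = \<sigma> ` {g \<in> S. (h \<circ> \<sigma>) g = j}" by auto
    moreover have "inj_on \<sigma> {g \<in> S. (h \<circ> \<sigma>) g = j}"
      using assms(2) by (rule inj_on_subset) auto
    ultimately show ?thesis by (simp add: sum.reindex)
  qed
  then show ?thesis using assms(1) unfolding can_split_def by metis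
qed

lemma finite_mms_values:
  assumes "finite S"
  shows "finite {Min ((\<lambda>j. sum v {g \<in> S. f g = j}) ` {..<d}) | f. f \<in> S \<rightarrow>\<^sub>E {..<d :: nat}}"
proof -
  have "finite (S \<rightarrow>\<^sub>E {..<d})" using assms by (intro finite_PiE) auto
  then show ?thesis by (simp add: setcompr_eq_image)
qed

lemma can_split_mms:
  assumes "finite S" "0 < d"
  shows "can_split v (mms d v S) d S"
proof -
  let ?X = "{Min ((\<lambda>j. sum v {g \<in> S. f g = j}) ` {..<d}) | f. f \<in> S \<rightarrow>\<^sub>E {..<d}}"
  have "restrict (\<lambda>_. 0) S \<in> S \<rightarrow>\<^sub>E {..<d}" using assms(2) by auto
  then have "?X \<noteq> {}" by blast
  then have "mms d v S \<in> ?X"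
    unfolding mms_def by (intro Max_in finite_mms_values assms(1))
  then obtain f where f: "mms d v S = Min ((\<lambda>j. sum v {g \<in> S. f g = j}) ` {..<d})"
    by blast
  have "\<forall>j\<in>{..<d}. mms d v S \<le> sum v {g \<in> S. f g = j}"
    unfolding f by (auto intro: Min_le)
  then show ?thesis unfolding can_split_def by (intro exI[of _ f] exI[of _ "{..<d}"]) auto
qed

text \<open>Once every good is assigned, renumbering the labels in \<open>J\<close> by
  \<open>{..<d}\<close> gives one of the assignments over which \<open>mms\<close> maximises.
  Together with \<open>can_split_mms\<close>, this allows the argument to work with
  \<open>can_split\<close> instead of the maximin share.\<close>

lemma mms_ge_if_can_split:
  assumes "can_split v t d S" "finite S" "\<forall>g\<in>S. 0 \<le> v g" "0 < d"
  shows "t \<le> mms d v S"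
proof -
  obtain h :: "'a \<Rightarrow> nat" and J where h: "finite J" "card J = d"
    "\<forall>j\<in>J. t \<le> sum v {g \<in> S. h g = j}" "\<forall>g. h g \<in> J"
    using can_split_surj[OF assms] by blast
  obtain \<beta> where \<beta>: "bij_betw \<beta> J {..<d}"
    using h(1,2) by (metis ex_bij_betw_finite_nat lessThan_atLeast0)
  define f where "f = restrict (\<beta> \<circ> h) S"
  have f: "f \<in> S \<rightarrow>\<^sub>E {..<d}"
    using \<beta> h(4) by (auto simp: f_def bij_betw_def)
  have "t \<le> sum v {g \<in> S. f g = j}" if j: "j \<in> {..<d}" for j
  proof -
    have "j \<in> \<beta> ` J" using j bij_betw_imp_surj_on[OF \<beta>] by simp
    then obtain j' where j': "j' \<in> J" "\<beta> j' = j" by (metis imageE)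
    have "{g \<in> S. f g = j} = {g \<in> S. h g = j'}"
      using \<beta> h(4) j' by (auto simp: f_def bij_betw_def inj_on_def)
    then show ?thesis using h(3) j' by simp
  qed
  then have "t \<le> Min ((\<lambda>j. sum v {g \<in> S. f g = j}) ` {..<d})"
    using assms(4) by (subst Min_ge_iff) auto
  also have "\<dots> \<le> mms d v S"
    unfolding mms_def using f by (intro Max_ge finite_mms_values assms(2)) blast
  finally show ?thesis .
qed

lemma can_split_le:
  assumes "can_split v t d S" "d' \<le> d"
  shows "can_split v t d' S"
proof -
  obtain h :: "'a \<Rightarrow> nat" and J where h: "finite J" "card J = d" "\<forall>j\<in>J. t \<le> sum v {g \<in> S. h g = j}"
    using assms(1) by (auto simp: can_split_def)
  obtain J' where "J' \<subseteq> J" "card J' = d'"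
    using obtain_subset_with_card_n assms(2) h(2) by metis
  then show ?thesis unfolding can_split_def
    using h finite_subset[of J' J] by (intro exI[of _ h] exI[of _ J']) auto
qed

section \<open>Removing goods from a splitting\<close>

lemma fibre_with_many_elements:
  assumes "finite J" "\<forall>g\<in>X. h g \<in> J" "finite X" "k * card J < card X"
  obtains j where "j \<in> J" "k < card {g \<in> X. h g = j}"
proof (rule ccontr)
  assume "\<not> thesis"
  then have le: "\<And>j. j \<in> J \<Longrightarrow> card {g \<in> X. h g = j} \<le> k" using that by force
  have "X = (\<Union>j\<in>J. {g \<in> X. h g = j})" using assms(2) by auto
  then have "card X \<le> (\<Sum>j\<in>J. card {g \<in> X. h g = j})"
    using card_UN_le[OF assms(1), of "\<lambda>j. {g \<in> X. h g = j}"] by simp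
  also have "\<dots> \<le> card J * k" using sum_bounded_above[of J _ k] le by force
  finally show False using assms(4) by (simp add: mult.commute)
qed

text \<open>Rules 1 to 3: by pigeonhole some bundle holds \<^term>\<open>card R\<close> goods of \<^term>\<open>F \<union> R\<close>. Its
  goods in \<^term>\<open>F\<close> replace the goods that the other bundles lose.\<close>
lemma can_split_remove_dominated:
  assumes split: "can_split u t n S" and fin: "finite S" and nonneg: "\<forall>g\<in>S. 0 \<le> u g"
    and "0 < n" and sub: "F \<subseteq> S" "R \<subseteq> S" and disj: "F \<inter> R = {}"
    and dom: "\<forall>x\<in>F. \<forall>r\<in>R. u r \<le> u x"
    and many: "R \<noteq> {} \<Longrightarrow> (card R - 1) * n < card (F \<union> R)"
  shows "can_split u t (n - 1) (S - R)"
proof (cases "R = {}")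
  case True
  then show ?thesis using can_split_le[OF split] by simp
next
  case False
  obtain h :: "'a \<Rightarrow> nat" and J where h: "finite J" "card J = n"
    "\<forall>j\<in>J. t \<le> sum u {g \<in> S. h g = j}" "\<forall>g. h g \<in> J"
    using can_split_surj[OF split fin nonneg \<open>0 < n\<close>] by blast
  have fFR: "finite F" "finite R" using sub fin finite_subset by auto
  obtain j0 where j0: "j0 \<in> J" "card R - 1 < card {g \<in> F \<union> R. h g = j0}"
    using fibre_with_many_elements[of J "F \<union> R" h "card R - 1"] h many[OF False] fFR by auto
  define B where "B = {g. h g = j0}"
  have "{g \<in> F \<union> R. h g = j0} = (F \<inter> B) \<union> (R \<inter> B)" by (auto simp: B_def)
  moreover have "card ((F \<inter> B) \<union> (R \<inter> B)) = card (F \<inter> B) + card (R \<inter> B)"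
    using disj fFR by (intro card_Un_disjoint) auto
  ultimately have "card {g \<in> F \<union> R. h g = j0} = card (F \<inter> B) + card (R \<inter> B)"
    by simp
  moreover have "card R = card (R - B) + card (R \<inter> B)"
    using fFR by (metis card_Int_Diff add.commute)
  ultimately have "card (R - B) \<le> card (F \<inter> B)" using j0(2) by linarith
  \<comment> \<open>The bundle \<open>B\<close> holds at least \<open>card R\<close> goods of
    \<open>F \<union> R\<close>, hence at least as many of \<open>F\<close> as there are goods of
    \<open>R\<close> outside it; \<open>\<phi>\<close> gives each of the latter its own substitute
    in \<open>B\<close>.\<close>
  then obtain \<phi> where \<phi>: "inj_on \<phi> (R - B)" "\<phi> ` (R - B) \<subseteq> F \<inter> B"
    using card_le_inj[of "R - B" "F \<inter> B"] fFR by auto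
  \<comment> \<open>A substitute joins the bundle of the good that it replaces; the rest of
    \<open>B\<close> keeps the label \<open>j0\<close>, which is given up.\<close>
  define h' where "h' g = (if g \<in> \<phi> ` (R - B) then h (inv_into (R - B) \<phi> g) else h g)" for g
  \<comment> \<open>Embeds an old bundle into the new one without loss of value. It is injective
    because substitutes lie in \<open>B\<close>, which is disjoint from the bundle.\<close>
  define \<psi> where "\<psi> g = (if g \<in> R then \<phi> g else g)" for g
  have "t \<le> sum u {g \<in> S - R. h' g = j}" if j: "j \<in> J - {j0}" for j
  proof -
    let ?C = "{g \<in> S. h g = j}"
    have nB: "g \<notin> B" if "g \<in> ?C" for g using that j by (auto simp: B_def)
    have \<psi>R: "\<psi> g \<in> F \<inter> B" if "g \<in> ?C" "g \<in> R" for g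
      using \<phi>(2) nB that by (auto simp: \<psi>_def)
    have inj: "inj_on \<psi> ?C"
    proof (rule inj_onI)
      fix x y assume xy: "x \<in> ?C" "y \<in> ?C" "\<psi> x = \<psi> y"
      show "x = y"
      proof (cases "x \<in> R \<longleftrightarrow> y \<in> R")
        case True
        then show ?thesis using xy nB \<phi>(1) by (auto simp: \<psi>_def inj_on_def split: if_splits)
      next
        case False
        then show ?thesis using xy nB \<psi>R by (metis IntD2 \<psi>_def)
      qed
    qed
    have img: "\<psi> ` ?C \<subseteq> {g \<in> S - R. h' g = j}"
    proof (rule image_subsetI)
      fix g assume g: "g \<in> ?C"
      show "\<psi> g \<in> {g \<in> S - R. h' g = j}"
      proof (cases "g \<in> R")
        case True
        then have "g \<in> R - B" using g nB by auto
        then have "h' (\<psi> g) = j" using g True \<phi>(1) by (simp add: h'_def \<psi>_def)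
        then show ?thesis using \<psi>R[OF g True] sub disj by auto
      next
        case False
        then have "g \<notin> \<phi> ` (R - B)" using nB[OF g] \<phi>(2) by auto
        then show ?thesis using g False by (simp add: h'_def \<psi>_def)
      qed
    qed
    have "t \<le> sum u ?C" using h(3) j by auto
    also have "\<dots> \<le> sum (u \<circ> \<psi>) ?C"
    proof (rule sum_mono)
      fix g assume g: "g \<in> ?C"
      show "u g \<le> (u \<circ> \<psi>) g"
      proof (cases "g \<in> R")
        case True
        then show ?thesis using \<psi>R[OF g True] dom by auto
      qed (simp add: \<psi>_def)
    qed
    also have "\<dots> = sum u (\<psi> ` ?C)" by (simp add: sum.reindex[OF inj])
    also have "\<dots> \<le> sum u {g \<in> S - R. h' g = j}"
      using fin nonneg by (intro sum_mono2 img) auto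
    finally show ?thesis .
  qed
  then show ?thesis unfolding can_split_def
    using h(1,2) j0(1) by (intro exI[of _ h'] exI[of _ "J - {j0}"]) auto
qed

text \<open>Rule 4: the bundles of the two removed goods are merged into one.\<close>
lemma can_split_remove_pair:
  assumes split: "can_split u t n S" and fin: "finite S" and nonneg: "\<forall>g\<in>S. 0 \<le> u g"
    and "0 < n" and xy: "x \<in> S" "y \<in> S" "x \<noteq> y" and le: "u x + u y \<le> t"
  shows "can_split u t (n - 1) (S - {x, y})"
proof -
  obtain h :: "'a \<Rightarrow> nat" and J where h: "finite J" "card J = n"
    "\<forall>j\<in>J. t \<le> sum u {g \<in> S. h g = j}" "\<forall>g. h g \<in> J"
    using can_split_surj[OF split fin nonneg \<open>0 < n\<close>] by blast
  define h' where "h' g = (if h g = h y then h x else h g)" for g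
  have "t \<le> sum u {g \<in> S - {x, y}. h' g = j}" if j: "j \<in> J - {h y}" for j
  proof (cases "j = h x")
    case True
    let ?X = "{g \<in> S. h g = h x}" and ?Y = "{g \<in> S. h g = h y}"
    have ne: "h x \<noteq> h y" using j True by auto
    have "{g \<in> S - {x, y}. h' g = j} = (?X - {x}) \<union> (?Y - {y})"
      using True ne by (auto simp: h'_def)
    moreover have "sum u ((?X - {x}) \<union> (?Y - {y})) = sum u (?X - {x}) + sum u (?Y - {y})"
      using fin ne by (intro sum.union_disjoint) auto
    ultimately have "sum u {g \<in> S - {x, y}. h' g = j} = sum u (?X - {x}) + sum u (?Y - {y})"
      by metis
    also have "\<dots> = sum u ?X - u x + (sum u ?Y - u y)"
      using fin xy by (simp add: sum_diff1)
    finally have "sum u {g \<in> S - {x, y}. h' g = j} = sum u ?X - u x + (sum u ?Y - u y)" .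
    moreover have "t \<le> sum u ?X" "t \<le> sum u ?Y" using h(3,4) by auto
    ultimately show ?thesis using le by linarith
  next
    case False
    then have "{g \<in> S - {x, y}. h' g = j} = {g \<in> S. h g = j}"
      using j by (auto simp: h'_def)
    then show ?thesis using h(3) j by auto
  qed
  then show ?thesis unfolding can_split_def
    using h by (intro exI[of _ h'] exI[of _ "J - {h y}"]) auto
qed

section \<open>Capping the values\<close>

text \<open>Values from \<^term>\<open>3/4 + \<epsilon>\<close> on are kept: such a good may form a bundle on its own, and rule 4
  never touches it, because rule 1 has priority.\<close>
definition truncate :: "real \<Rightarrow> real \<Rightarrow> real" where
  "truncate \<epsilon> x = (if 3/4 + \<epsilon> \<le> x then x
     else if 1/4 + \<epsilon>/3 < x then min x (3/4 * (1 - 4 * \<epsilon>))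
     else min x (1/4 * (1 - 4 * \<epsilon>)))"

lemma truncate_le: "truncate \<epsilon> x \<le> x"
  by (simp add: truncate_def)

lemma truncate_nonneg: "\<epsilon> < 1/4 \<Longrightarrow> 0 \<le> x \<Longrightarrow> 0 \<le> truncate \<epsilon> x"
  by (simp add: truncate_def)

text \<open>The caps grow from class to class, and the larger one,
  \<open>3/4 * (1 - 4 * \<epsilon>)\<close>, is at most \<open>3/4 + \<epsilon>\<close>, where
  values are kept. So goods sorted by value stay sorted by capped value, as the exchange of goods
  for rules 1 to 3 requires.\<close>

lemma truncate_mono:
  assumes "0 \<le> \<epsilon>" "\<epsilon> < 1/4" "x \<le> y"
  shows "truncate \<epsilon> x \<le> truncate \<epsilon> y"
  using assms by (auto simp: truncate_def min_def)

text \<open>Give a good of \<open>P\<close> weight 3 and a good of \<open>Q\<close> weight 1: each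
  unit of weight guarantees \<open>1/4 * T\<close> and costs at most
  \<open>4/3 * \<epsilon>\<close>. The total weight is an integer, so either at least 4 units
  guarantee \<open>T\<close>, or at most 3 units cost at most \<open>4 * \<epsilon>\<close>.\<close>

lemma sum_truncate_ge:
  assumes eps: "0 \<le> \<epsilon>" "\<epsilon> < 1/4" and fin: "finite B" and nonneg: "\<forall>g\<in>B. 0 \<le> w g"
    and ge: "1 \<le> sum w B"
  shows "1 - 4 * \<epsilon> \<le> (\<Sum>g\<in>B. truncate \<epsilon> (w g))"
proof -
  define T where "T = 1 - 4 * \<epsilon>"
  define Q where "Q = {g \<in> B. 1/4 * T < w g \<and> w g \<le> 1/4 + \<epsilon>/3}"
  \<comment> \<open>\<open>P\<close> also holds the goods worth \<open>3/4 + \<epsilon>\<close> or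
    more: they lose nothing and guarantee \<open>3/4 * T\<close>. Goods outside \<open>P\<close> and
    \<open>Q\<close> keep their value.\<close>
  define P where "P = {g \<in> B. 1/4 + \<epsilon>/3 < w g \<and> 3/4 * T \<le> w g}"
  let ?f = "\<lambda>g. truncate \<epsilon> (w g)"
  have T: "0 < T" using eps by (simp add: T_def)
  have fins: "finite P" "finite Q" using fin by (auto simp: P_def Q_def)
  have PQ: "P \<inter> Q = {}" "P \<union> Q \<subseteq> B" by (auto simp: P_def Q_def)
  have fP: "3/4 * T \<le> ?f g" "w g - ?f g \<le> 4 * \<epsilon>" if "g \<in> P" for g
    using that eps by (auto simp: P_def T_def truncate_def min_def field_simps)
  have fQ: "1/4 * T \<le> ?f g" "w g - ?f g \<le> 4/3 * \<epsilon>" if "g \<in> Q" for g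
    using that eps by (auto simp: Q_def T_def truncate_def min_def field_simps)
  have f0: "w g - ?f g \<le> 0" if "g \<in> B - (P \<union> Q)" for g
    using that eps by (auto simp: P_def Q_def T_def truncate_def min_def)
  have "sum ?f (P \<union> Q) \<le> sum ?f B"
    using fin PQ nonneg truncate_nonneg[OF eps(2)] by (intro sum_mono2) auto
  moreover have "sum ?f (P \<union> Q) = sum ?f P + sum ?f Q"
    using fins PQ by (simp add: sum.union_disjoint)
  moreover have "of_nat (card P) * (3/4 * T) \<le> sum ?f P" "of_nat (card Q) * (1/4 * T) \<le> sum ?f Q"
    by (intro sum_bounded_below fP(1) fQ(1); assumption)+
  ultimately have low: "(3 * card P + card Q) * (1/4 * T) \<le> sum ?f B"
    by (simp add: algebra_simps)
  have "sum (\<lambda>g. w g - ?f g) B = sum (\<lambda>g. w g - ?f g) (B - (P \<union> Q)) + sum (\<lambda>g. w g - ?f g) (P \<union> Q)"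
    using PQ(2) fin by (rule sum.subset_diff)
  moreover have "sum (\<lambda>g. w g - ?f g) (P \<union> Q) = sum (\<lambda>g. w g - ?f g) P + sum (\<lambda>g. w g - ?f g) Q"
    using fins PQ by (intro sum.union_disjoint) auto
  moreover have "sum (\<lambda>g. w g - ?f g) P \<le> of_nat (card P) * (4 * \<epsilon>)"
    "sum (\<lambda>g. w g - ?f g) Q \<le> of_nat (card Q) * (4/3 * \<epsilon>)"
    by (intro sum_bounded_above fP(2) fQ(2); assumption)+
  moreover have "sum (\<lambda>g. w g - ?f g) (B - (P \<union> Q)) \<le> 0" using f0 by (intro sum_nonpos) auto
  ultimately have loss: "sum w B - sum ?f B \<le> (3 * card P + card Q) * (4/3 * \<epsilon>)"
    by (simp add: sum_subtractf algebra_simps)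
  show ?thesis
  proof (cases "3 * card P + card Q \<le> 3")
    case True
    then have "(3 * card P + card Q) * (4/3 * \<epsilon>) \<le> 3 * (4/3 * \<epsilon>)"
      using eps by (intro mult_right_mono) auto
    then show ?thesis using loss ge by linarith
  next
    case False
    then have "4 * (1/4 * T) \<le> (3 * card P + card Q) * (1/4 * T)"
      using T by (intro mult_right_mono) auto
    then show ?thesis using low by (simp add: T_def)
  qed
qed

lemma can_split_truncate:
  assumes "0 \<le> \<epsilon>" "\<epsilon> < 1/4" "finite S" "\<forall>g\<in>S. 0 \<le> w g" "can_split w 1 n S"
  shows "can_split (truncate \<epsilon> \<circ> w) (1 - 4 * \<epsilon>) n S"
proof -
  have "1 - 4 * \<epsilon> \<le> sum (truncate \<epsilon> \<circ> w) {g \<in> S. h g = j}"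
    if "1 \<le> sum w {g \<in> S. h g = j}" for h :: "'a \<Rightarrow> nat" and j
    using sum_truncate_ge[OF assms(1,2) _ _ that] assms(3,4) by auto
  then show ?thesis using assms(5) unfolding can_split_def by blast
qed

section \<open>Positions in the list of remaining goods\<close>

lemma positions_image: "(\<lambda>p. G ! (p - 1)) ` {1..length G} = set G"
proof -
  have "G ! q \<in> (\<lambda>p. G ! (p - 1)) ` {1..length G}" if "q < length G" for q
    using that by (intro image_eqI[of _ _ "Suc q"]) auto
  moreover have "G ! (p - 1) \<in> set G" if "p \<in> {1..length G}" for p
    using that by auto
  ultimately show ?thesis by (force simp: in_set_conv_nth)
qed

lemma inj_on_positions:
  assumes "sorted_wrt (<) (G :: nat list)"
  shows "inj_on (\<lambda>p. G ! (p - 1)) {1..length G}"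
proof -
  have "distinct G" using assms strict_sorted_iff by blast
  then show ?thesis by (auto simp: inj_on_def nth_eq_iff_index_eq)
qed

lemma positions_mono:
  assumes "sorted_wrt (<) (G :: nat list)" "p < q" "1 \<le> p" "q \<le> length G"
  shows "G ! (p - 1) < G ! (q - 1)"
  using assms by (intro sorted_wrt_nth_less[of "(<)"]) auto

lemma set_remove_pos:
  assumes "sorted_wrt (<) G"
  shows "set (remove_pos k A G) = set G - rule_goods k A G"
proof -
  have "set (remove_pos k A G) = (\<lambda>p. G ! (p - 1)) ` ({1..length G} - rule_pos k (card A) \<inter> {1..length G})"
    by (auto simp: remove_pos_def)
  also have "\<dots> = set G - rule_goods k A G"
    unfolding rule_goods_def positions_image[symmetric]
    by (rule inj_on_image_set_diff[OF inj_on_positions[OF assms]]) auto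
  finally show ?thesis .
qed

lemma sorted_remove_pos:
  assumes "sorted_wrt (<) G"
  shows "sorted_wrt (<) (remove_pos k A G)"
proof -
  have "sorted_wrt (<) (filter (\<lambda>p. p \<notin> rule_pos k (card A)) [1..<Suc (length G)])"
    by (intro sorted_wrt_filter) (simp del: upt_Suc)
  then have "sorted_wrt (\<lambda>p q. G ! (p - 1) < G ! (q - 1))
      (filter (\<lambda>p. p \<notin> rule_pos k (card A)) [1..<Suc (length G)])"
    by (rule sorted_wrt_mono_rel[rotated]) (use positions_mono[OF assms] in \<open>auto simp del: upt_Suc\<close>)
  then show ?thesis unfolding remove_pos_def by (simp add: sorted_wrt_map)
qed

section \<open>One application of a reduction rule\<close>

text \<open>Rules 1, 2 and 3 are the cases \<open>c\<close> = 0, 2, 3. The interval has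
  \<open>c + 1\<close> positions and is preceded by \<open>c * (n - 1)\<close> goods worth no less,
  which is just enough for the pigeonhole argument with \<open>n\<close> bundles.\<close>

lemma can_split_remove_interval:
  assumes split: "can_split u t n (set G)" and srt: "sorted_wrt (<) (G :: nat list)"
    and nonneg: "\<forall>g\<in>set G. 0 \<le> u g" and "0 < n"
    and anti: "\<forall>g\<in>set G. \<forall>g'\<in>set G. g \<le> g' \<longrightarrow> u g' \<le> u g"
  shows "can_split u t (n - 1)
    (set G - (\<lambda>p. G ! (p - 1)) ` ({c * (n - 1) + 1..c * n + 1} \<inter> {1..length G}))"
proof (rule can_split_remove_dominated[OF split _ nonneg \<open>0 < n\<close>])
  let ?g = "\<lambda>p. G ! (p - 1)"
  let ?F = "{1..c * (n - 1)} \<inter> {1..length G}"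
  let ?R = "{c * (n - 1) + 1..c * n + 1} \<inter> {1..length G}"
  note inj = inj_on_positions[OF srt]
  show "?g ` ?F \<subseteq> set G" "?g ` ?R \<subseteq> set G" using positions_image[of G] by auto
  show "?g ` ?F \<inter> ?g ` ?R = {}"
    using inj_on_image_Int[OF inj, of ?F ?R] by auto
  show "\<forall>x\<in>?g ` ?F. \<forall>r\<in>?g ` ?R. u r \<le> u x"
  proof safe
    fix p q assume "p \<in> {1..c * (n - 1)}" "p \<in> {1..length G}"
      "q \<in> {c * (n - 1) + 1..c * n + 1}" "q \<in> {1..length G}"
    then have "?g p \<in> set G" "?g q \<in> set G" "?g p < ?g q"
      using positions_mono[OF srt, of p q] by auto
    then show "u (?g q) \<le> u (?g p)" using anti by auto
  qed
  assume "?g ` ?R \<noteq> {}"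
  \<comment> \<open>The list may end inside the interval, but once one of its positions exists, all
    positions in \<open>?F\<close> do, so \<open>card ?F\<close> is exact.\<close>
  then have L: "c * (n - 1) < length G" by auto
  have eq: "c * n = c * (n - 1) + c" using \<open>0 < n\<close> by (cases n) auto
  have cR: "card (?g ` ?R) = card ?R" by (rule card_image[OF inj_on_subset[OF inj]]) auto
  have "card (?g ` ?F \<union> ?g ` ?R) = card (?F \<union> ?R)"
    unfolding image_Un[symmetric] by (rule card_image[OF inj_on_subset[OF inj]]) auto
  also have "\<dots> = card ?F + card ?R" by (rule card_Un_disjoint) auto
  also have "card ?F = c * (n - 1)" using L by (simp add: Int_atLeastAtMost min_def)
  finally have c: "card (?g ` ?F \<union> ?g ` ?R) = c * (n - 1) + card ?R" .
  have "?R = {c * (n - 1) + 1..min (c * n + 1) (length G)}" by auto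
  then have "card ?R = min (c * n + 1) (length G) - c * (n - 1)" by simp
  then have R: "0 < card ?R" "card ?R - 1 \<le> c" using L eq by auto
  have "(card ?R - 1) * n = (card ?R - 1) * (n - 1) + (card ?R - 1)"
    using \<open>0 < n\<close> by (cases n) auto
  also have "\<dots> < c * (n - 1) + card ?R"
    using R mult_right_mono[OF R(2), of "n - 1"] by linarith
  finally show "(card (?g ` ?R) - 1) * n < card (?g ` ?F \<union> ?g ` ?R)"
    unfolding c cR .
qed simp

text \<open>The agent \<open>i\<close> is any agent still present, not necessarily the one served.
  The removed goods form an interval, where goods are exchanged, or a pair, where two bundles are
  merged.\<close>

lemma can_split_step:
  assumes k: "k \<in> {1..4}" and napp: "\<forall>k'\<in>{1..<k}. \<not> applicable w (3/4 + \<epsilon>) k' A G"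
    and fin: "finite A" and i: "i \<in> A" and srt: "sorted_wrt (<) G"
    and eps: "0 \<le> \<epsilon>" "\<epsilon> < 1/4" and nonneg: "\<forall>g\<in>set G. 0 \<le> w i g"
    and anti: "\<forall>g\<in>set G. \<forall>g'\<in>set G. g \<le> g' \<longrightarrow> w i g' \<le> w i g"
    and split: "can_split (truncate \<epsilon> \<circ> w i) (1 - 4 * \<epsilon>) (card A) (set G)"
  shows "can_split (truncate \<epsilon> \<circ> w i) (1 - 4 * \<epsilon>) (card A - 1) (set (remove_pos k A G))"
proof -
  let ?u = "truncate \<epsilon> \<circ> w i" and ?n = "card A" and ?g = "\<lambda>p. G ! (p - 1)"
  have n: "0 < ?n" using fin i card_gt_0_iff by blast
  have u0: "\<forall>g\<in>set G. 0 \<le> ?u g" using nonneg truncate_nonneg[OF eps(2)] by auto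
  have uanti: "\<forall>g\<in>set G. \<forall>g'\<in>set G. g \<le> g' \<longrightarrow> ?u g' \<le> ?u g"
    using anti truncate_mono[OF eps] by auto
  note remove = can_split_remove_interval[OF split srt u0 n uanti]
  \<comment> \<open>With fewer than \<open>2 * ?n + 1\<close> goods, rule 4 removes at most the
    first good, which is the interval for \<open>c\<close> = 0.\<close>
  consider (interval) c where "rule_goods k A G = ?g ` ({c * (?n - 1) + 1..c * ?n + 1} \<inter> {1..length G})"
    | (pair) "k = 4" "2 * ?n + 1 \<le> length G"
  proof -
    have "rule_pos 1 ?n = {0 * (?n - 1) + 1..0 * ?n + 1}" by (auto simp: rule_pos_def)
    moreover have "rule_pos 2 ?n = {2 * (?n - 1) + 1..2 * ?n + 1}"
      using n by (auto simp: rule_pos_def)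
    moreover have "rule_pos 3 ?n = {3 * (?n - 1) + 1..3 * ?n + 1}"
      using n by (auto simp: rule_pos_def)
    moreover have "rule_pos 4 ?n \<inter> {1..length G} = {0 * (?n - 1) + 1..0 * ?n + 1} \<inter> {1..length G}"
      if "\<not> 2 * ?n + 1 \<le> length G"
      using that by (auto simp: rule_pos_def)
    moreover have "k = 1 \<or> k = 2 \<or> k = 3 \<or> k = 4" using k by auto
    ultimately show thesis using that unfolding rule_goods_def by metis
  qed
  then show ?thesis
  proof cases
    case interval
    then show ?thesis unfolding set_remove_pos[OF srt] by (simp only: remove)
  next
    case pair
    let ?x = "?g 1" and ?y = "?g (2 * ?n + 1)"
    \<comment> \<open>Priority of the rules: rules 1 and 2 are not applicable to any agent, in
      particular not to \<open>i\<close>.\<close>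
    have napp': "sum (w i) (rule_goods k' A G) < 3/4 + \<epsilon>" if "k' \<in> {1, 2}" for k'
    proof -
      have "\<not> applicable w (3/4 + \<epsilon>) k' A G" using napp that pair(1) by auto
      then show ?thesis using i unfolding applicable_def by (meson not_le)
    qed
    have goods: "rule_goods k A G = {?x, ?y}"
      using pair by (auto simp: rule_goods_def rule_pos_def)
    have "?x \<in> set G" "?y \<in> set G" using pair(2) by (intro nth_mem; linarith)+
    moreover have "?x \<noteq> ?y" using pair(2) n positions_mono[OF srt, of 1 "2 * ?n + 1"] by auto
    ultimately have xy: "?x \<in> set G" "?y \<in> set G" "?x \<noteq> ?y" .
    have "rule_goods 1 A G = {?x}" using pair(2) by (auto simp: rule_goods_def rule_pos_def)
    then have wx: "w i ?x < 3/4 + \<epsilon>" using napp'[of 1] by simp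
    \<comment> \<open>\<open>?y\<close> is the last and so least valued of the three goods of rule
      2; as that rule fails for \<open>i\<close>, three times its value is below
      \<open>3/4 + \<epsilon>\<close>.\<close>
    let ?R = "?g ` {2 * ?n - 1..2 * ?n + 1}"
    have "rule_pos 2 ?n \<inter> {1..length G} = {2 * ?n - 1..2 * ?n + 1}"
      using n pair(2) by (auto simp: rule_pos_def)
    then have R2: "rule_goods 2 A G = ?R" by (simp add: rule_goods_def)
    have "card ?R = card {2 * ?n - 1..2 * ?n + 1}"
      using pair(2) n by (intro card_image inj_on_subset[OF inj_on_positions[OF srt]]) auto
    then have "card ?R = 3" using n by simp
    moreover have "w i ?y \<le> w i r" if r: "r \<in> ?R" for r
    proof -
      obtain p where p: "p \<in> {2 * ?n - 1..2 * ?n + 1}" "r = ?g p" using r by blast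
      then have "r \<in> set G" using pair(2) n by auto
      moreover have "r \<le> ?y"
      proof (cases "p = 2 * ?n + 1")
        case False
        then have "p < 2 * ?n + 1" "1 \<le> p" using p n by auto
        then show ?thesis using positions_mono[OF srt] pair(2) p(2) less_imp_le by blast
      qed (use p in simp)
      ultimately show ?thesis using anti xy by blast
    qed
    ultimately have "3 * w i ?y \<le> sum (w i) ?R"
      using sum_bounded_below[of ?R "w i ?y" "w i"] by simp
    then have wy: "w i ?y < 1/4 + \<epsilon>/3" using napp'[of 2] R2 by simp
    \<comment> \<open>Below \<open>3/4 + \<epsilon>\<close> both caps are at most
      \<open>3/4 * (1 - 4 * \<epsilon>)\<close>, so the class of \<open>?x\<close> does not matter;
      \<open>?y\<close> lies in the lowest class.\<close>
    have "?u ?x \<le> 3/4 * (1 - 4 * \<epsilon>)" "?u ?y \<le> 1/4 * (1 - 4 * \<epsilon>)"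
      using wx wy eps by (auto simp: truncate_def min_def)
    then have "?u ?x + ?u ?y \<le> 1 - 4 * \<epsilon>" by simp
    from can_split_remove_pair[OF split finite_set u0 n xy this]
    show ?thesis unfolding set_remove_pos[OF srt] goods .
  qed
qed

section \<open>The reduction loop\<close>

lemma reduce_loop_agents: "reduce_loop w \<alpha> A G A' G' \<Longrightarrow> A' \<subseteq> A"
  by (induction rule: reduce_loop.induct) auto

text \<open>Splittability of the fixed capped values is the loop invariant: each step lowers the
  number of agents and of required bundles by one, and an agent of the output is present in every
  step.\<close>

lemma can_split_reduce_loop:
  assumes "reduce_loop w (3/4 + \<epsilon>) A G A' G'" "i \<in> A'" "finite A" "sorted_wrt (<) G"
    "0 \<le> \<epsilon>" "\<epsilon> < 1/4" "\<forall>g\<in>set G. 0 \<le> w i g"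
    "\<forall>g\<in>set G. \<forall>g'\<in>set G. g \<le> g' \<longrightarrow> w i g' \<le> w i g"
    "can_split (truncate \<epsilon> \<circ> w i) (1 - 4 * \<epsilon>) (card A) (set G)"
  shows "can_split (truncate \<epsilon> \<circ> w i) (1 - 4 * \<epsilon>) (card A') (set G')"
  using assms
proof (induction rule: reduce_loop.induct)
  case (stop A G)
  then show ?case by simp
next
  case (step k A G a A' G')
  have iA: "i \<in> A" using reduce_loop_agents[OF step.hyps(6)] step.prems(1) by auto
  have sub: "set (remove_pos k A G) \<subseteq> set G" using set_remove_pos step.prems by auto
  have "can_split (truncate \<epsilon> \<circ> w i) (1 - 4 * \<epsilon>) (card A - 1) (set (remove_pos k A G))"
    by (rule can_split_step[OF step.hyps(1,3) step.prems(2) iA step.prems(3-8)])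
  then have "can_split (truncate \<epsilon> \<circ> w i) (1 - 4 * \<epsilon>) (card (A - {a})) (set (remove_pos k A G))"
    using step.hyps(4) by simp
  then show ?case
    using step.prems(1-7) sub sorted_remove_pos by (intro step.IH) (assumption | blast)+
qed

lemma reduce_loop_goods:
  "reduce_loop w \<alpha> A G A' G' \<Longrightarrow> sorted_wrt (<) G \<Longrightarrow> set G' \<subseteq> set G"
proof (induction rule: reduce_loop.induct)
  case (step k A G a A' G')
  then show ?case using set_remove_pos[of G k A] sorted_remove_pos[of G k A] by blast
qed simp

section \<open>The ordered and normalised instance\<close>

text \<open>Sorting the goods themselves by \<open>v i\<close> names the good behind each rank. The
  bijection depends on the agent, and carries a partition of \<open>M\<close> over to the
  ranks.\<close>

lemma ordv_bij:
  assumes "finite M"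
  obtains \<sigma> where "bij_betw \<sigma> {1..card M} M" "\<forall>j\<in>{1..card M}. ordv M v i j = v i (\<sigma> j)"
proof -
  obtain xs where xs: "set xs = M" "distinct xs" using assms finite_distinct_list by blast
  define ys where "ys = sort_key (v i) xs"
  have ys: "set ys = M" "distinct ys" "length ys = card M"
    using xs by (auto simp: ys_def distinct_card)
  have "mset_set M = mset ys" using ys mset_set_set by blast
  then have "sorted_list_of_multiset (image_mset (v i) (mset_set M)) = map (v i) ys"
    by (simp add: sorted_sort_id ys_def flip: mset_map del: mset_sort)
  then have ordv: "ordv M v i j = v i (rev ys ! (j - 1))" if "j \<in> {1..card M}" for j
    using that ys by (auto simp: ordv_def rev_map)
  have "bij_betw (\<lambda>j. rev ys ! (j - 1)) {1..card M} M"
    unfolding bij_betw_def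
  proof
    show "inj_on (\<lambda>j. rev ys ! (j - 1)) {1..card M}"
      using ys by (auto simp: inj_on_def nth_eq_iff_index_eq)
    show "(\<lambda>j. rev ys ! (j - 1)) ` {1..card M} = M"
      using positions_image[of "rev ys"] ys by simp
  qed
  then show thesis using that ordv by blast
qed

lemma ordv_antimono:
  assumes "1 \<le> j" "j \<le> j'" "j' \<le> card M"
  shows "ordv M v i j' \<le> ordv M v i j"
proof -
  let ?xs = "sorted_list_of_multiset (image_mset (v i) (mset_set M))"
  have "length ?xs = card M" by (metis size_image_mset size_mset size_mset_set mset_sorted_list_of_multiset)
  moreover have "sorted ?xs" by simp
  ultimately have "rev ?xs ! (j' - 1) \<le> rev ?xs ! (j - 1)"
    using assms by (intro sorted_rev_nth_mono) auto
  then show ?thesis using assms by (simp add: ordv_def)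
qed

text \<open>Normalisation divides by the share in the ordered instance, while positivity is assumed
  for the original one; an optimal splitting is transported along \<open>\<sigma>\<close>.\<close>

lemma mms_ordv_pos:
  assumes "finite M" "\<forall>g\<in>M. 0 \<le> v i g" "0 < mms n (v i) M" "0 < n"
  shows "0 < mms n (ordv M v i) {1..card M}"
proof -
  obtain \<sigma> where \<sigma>: "bij_betw \<sigma> {1..card M} M" "\<forall>j\<in>{1..card M}. ordv M v i j = v i (\<sigma> j)"
    using ordv_bij[OF assms(1)] by blast
  have "can_split (v i) (mms n (v i) M) n (\<sigma> ` {1..card M})"
    using can_split_mms[OF assms(1,4)] \<sigma>(1) by (simp add: bij_betw_def)
  then have "can_split (v i \<circ> \<sigma>) (mms n (v i) M) n {1..card M}"
    using \<sigma>(1) by (intro can_split_bij) (auto simp: bij_betw_def)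
  then have "can_split (ordv M v i) (mms n (v i) M) n {1..card M}"
    by (rule can_split_cong) (use \<sigma>(2) in auto)
  moreover have "\<forall>j\<in>{1..card M}. 0 \<le> ordv M v i j"
    using \<sigma> assms(2) by (auto simp: bij_betw_def)
  ultimately have "mms n (v i) M \<le> mms n (ordv M v i) {1..card M}"
    using assms(4) by (intro mms_ge_if_can_split) auto
  then show ?thesis using assms(3) by simp
qed

section \<open>From capped values back to the maximin share\<close>

theorem theorem13:
  fixes N :: "nat set" and M :: "'g set" and v :: "nat \<Rightarrow> 'g \<Rightarrow> real" and \<epsilon> :: real
    and N' :: "nat set" and M' :: "nat set" and i :: nat
  assumes "finite N" and "finite M"
    and "\<forall>a\<in>N. \<forall>g\<in>M. v a g \<ge> 0"
    and "\<forall>a\<in>N. mms (card N) (v a) M > 0"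
    and "\<epsilon> \<ge> 0"
    and "reduce N M v \<epsilon> N' M'"
    and "i \<in> N'"
  shows "mms (card N') (normv N M v i) M' \<ge> 1 - 4 * \<epsilon>"
proof -
  define w where "w = normv N M v"
  define \<mu> where "\<mu> = mms (card N) (ordv M v i) {1..card M}"
  obtain G' where G': "reduce_loop w (3/4 + \<epsilon>) N [1..<Suc (card M)] N' G'" "M' = set G'"
    using assms(6) by (auto simp: reduce_def w_def)
  have setG: "set [1..<Suc (card M)] = {1..card M}" by auto
  have srt: "sorted_wrt (<) [1..<Suc (card M)]" by (simp del: upt_Suc)
  have "N' \<subseteq> N" using reduce_loop_agents[OF G'(1)] .
  then have i: "i \<in> N" and n: "0 < card N" "0 < card N'"
    using assms(1,7) by (auto simp: card_gt_0_iff intro: finite_subset)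
  have M': "M' \<subseteq> {1..card M}" using reduce_loop_goods[OF G'(1) srt] G'(2) setG by auto
  have \<mu>: "0 < \<mu>" unfolding \<mu>_def using assms i n by (intro mms_ordv_pos) auto
  have w: "w i j = ordv M v i j / \<mu>" for j by (simp add: w_def normv_def \<mu>_def)
  obtain \<sigma> where \<sigma>: "bij_betw \<sigma> {1..card M} M" "\<forall>j\<in>{1..card M}. ordv M v i j = v i (\<sigma> j)"
    using ordv_bij[OF assms(2)] by blast
  have "\<forall>j\<in>{1..card M}. 0 \<le> v i (\<sigma> j)"
    using \<sigma>(1) assms(3) i by (auto simp: bij_betw_def)
  then have w0: "\<forall>j\<in>{1..card M}. 0 \<le> w i j"
    using \<sigma>(2) \<mu> by (simp add: w)
  have anti: "\<forall>j\<in>{1..card M}. \<forall>j'\<in>{1..card M}. j \<le> j' \<longrightarrow> w i j' \<le> w i j"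
    unfolding w using \<mu> by (auto intro!: divide_right_mono ordv_antimono)
  have "can_split (ordv M v i) \<mu> (card N) {1..card M}"
    unfolding \<mu>_def using n by (intro can_split_mms) auto
  then have split: "can_split (w i) 1 (card N) {1..card M}"
    using \<mu> by (simp add: can_split_def w flip: sum_divide_distrib)
  have "can_split (w i) (1 - 4 * \<epsilon>) (card N') M'"
  proof (cases "\<epsilon> < 1/4")
    case True
    have "can_split (truncate \<epsilon> \<circ> w i) (1 - 4 * \<epsilon>) (card N) {1..card M}"
      using True assms(5) w0 split by (intro can_split_truncate) auto
    then have "can_split (truncate \<epsilon> \<circ> w i) (1 - 4 * \<epsilon>) (card N') M'"
      unfolding G'(2) using True assms w0 anti srt
      by (intro can_split_reduce_loop[OF G'(1)]) (simp_all only: setG)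
    then show ?thesis by (rule can_split_mono) (simp add: truncate_le)
  next
    case False
    \<comment> \<open>The bound is at most 0 here, so any assignment will do; the goods are natural
      numbers and can serve as their own labels.\<close>
    have "0 \<le> sum (w i) {g \<in> M'. id g = j}" for j
      using w0 M' by (intro sum_nonneg) auto
    then show ?thesis unfolding can_split_def using False
      by (intro exI[of _ id] exI[of _ "{..<card N'}"]) (auto intro: order_trans[of _ 0])
  qed
  then show ?thesis
    unfolding w_def[symmetric] using n M' w0 finite_subset
    by (intro mms_ge_if_can_split) auto
qed

end
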